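(* Let $k$ be a positive real number, and let $t_1>t_2$ be the roots of the equation $x^{2}-(k^{2}+2)x+1=0$. Then for every integer $n\ge 0$ the rising $k$-binomial transform $(r_{k,n})_{n\ge 0}$ of the modified $k$-Fibonacci-like sequence is given by $$r_{k,n}= (2k+2)\,\frac{t_{1}^{n}-t_{2}^{n}}{t_{1}-t_{2}}- 2\,\frac{t_{1}^{n-1}-t_{2}^{n-1}}{t_{1}-t_{2}}.$$
   Context: For a positive real number $k$, the modified $k$-Fibonacci-like sequence $(M_{k,n})_{n\ge 0}$ is defined by $M_{k,0}=M_{k,1}=2$ and $M_{k,n+1}=kM_{k,n}+M_{k,n-1}$ for $n\ge 1$. Its rising $k$-binomial transform $(r_{k,n})_{n\ge 0}$ is defined by $r_{k,n}=\sum_{i=0}^{n}\binom{n}{i}k^{i}M_{k,i}$. Exponents are integer exponents (for $n=0$ the exponent $n-1$ equals $-1$). *)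

theory Defs
  imports Complex_Main
begin

fun mod_k_fib :: "real \<Rightarrow> nat \<Rightarrow> real" where
  "mod_k_fib k 0 = 2"
| "mod_k_fib k (Suc 0) = 2"
| "mod_k_fib k (Suc (Suc n)) = k * mod_k_fib k (Suc n) + mod_k_fib k n"

definition rising_k_binomial_transform :: "real \<Rightarrow> (nat \<Rightarrow> real) \<Rightarrow> nat \<Rightarrow> real" where
  "rising_k_binomial_transform k a n = (\<Sum>i=0..n. real (n choose i) * k ^ i * a i)"

end

theory Submission
  imports Defs
begin

text \<open>
  The proof uses no closed form of the \<open>k\<close>-Fibonacci-like sequence. Pascal's rule says that
  passing from index \<open>n\<close> to \<open>n + 1\<close> in the rising transform acts as the operator
  \<open>1 + k E\<close> on the sequence, where \<open>E\<close> is the shift. If \<open>E\<close> is annihilated by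
  \<open>x\<^sup>2 - k x - 1\<close>, then \<open>y = 1 + k E\<close> is annihilated by \<open>y\<^sup>2 - (k\<^sup>2 + 2) y + 1\<close>: the
  recurrence with step \<open>k\<close> for the sequence becomes the recurrence
  \<open>r (n + 2) = (k\<^sup>2 + 2) r (n + 1) - r n\<close> for its transform. By Vieta,
  \<open>t1\<close> and \<open>t2\<close> have sum \<open>k\<^sup>2 + 2\<close> and product \<open>1\<close>, so Binet's formula with the initial
  values \<open>r 0 = 2\<close> and \<open>r 1 = 2 k + 2\<close> gives the claim.
\<close>

text \<open>Pascal's rule splits the sum for \<open>n + 1\<close> into the subsets that avoid a chosen element
  and those that contain it; the latter contribute one more factor \<open>k\<close> and a shifted index.\<close>

lemma rising_k_binomial_transform_Suc:
  "rising_k_binomial_transform k a (Suc n) =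
     rising_k_binomial_transform k a n
     + k * rising_k_binomial_transform k (\<lambda>i. a (Suc i)) n"
proof -
  let ?f = "\<lambda>i. k ^ i * a i"
  have "rising_k_binomial_transform k a (Suc n) =
      a 0 + (\<Sum>i\<le>n. real (Suc n choose Suc i) * ?f (Suc i))"
    unfolding rising_k_binomial_transform_def atLeast0AtMost
    by (subst sum.atMost_Suc_shift) (simp add: mult.assoc)
  also have "\<dots> = a 0 + (\<Sum>i\<le>n. real (n choose Suc i) * ?f (Suc i))
      + (\<Sum>i\<le>n. real (n choose i) * ?f (Suc i))"
    by (simp add: algebra_simps sum.distrib)
  also have "a 0 + (\<Sum>i\<le>n. real (n choose Suc i) * ?f (Suc i)) =
      (\<Sum>i\<le>Suc n. real (n choose i) * ?f i)"
    by (subst sum.atMost_Suc_shift) simp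
  also have "\<dots> = rising_k_binomial_transform k a n"
    by (simp add: rising_k_binomial_transform_def atLeast0AtMost mult.assoc)
  also have "(\<Sum>i\<le>n. real (n choose i) * ?f (Suc i)) =
      k * rising_k_binomial_transform k (\<lambda>i. a (Suc i)) n"
    by (simp add: rising_k_binomial_transform_def atLeast0AtMost sum_distrib_left mult_ac)
  finally show ?thesis .
qed

lemma rising_k_binomial_transform_linear:
  "rising_k_binomial_transform k (\<lambda>i. c * a i + b i) n =
     c * rising_k_binomial_transform k a n + rising_k_binomial_transform k b n"
  by (simp add: rising_k_binomial_transform_def sum_distrib_left sum.distrib algebra_simps)

text \<open>Applying Pascal's rule to \<open>a\<close> and to its shift \<open>b\<close> gives a linear system for the two
  transforms, which closes up because the shift of \<open>b\<close> is \<open>k b + a\<close>. Its matrix has trace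
  \<open>k\<^sup>2 + 2\<close> and determinant \<open>1\<close>, whence the recurrence.\<close>

lemma rising_k_binomial_transform_recurrence:
  assumes "\<And>i. a (Suc (Suc i)) = k * a (Suc i) + a i"
  shows "rising_k_binomial_transform k a (Suc (Suc n)) =
     (k\<^sup>2 + 2) * rising_k_binomial_transform k a (Suc n) - rising_k_binomial_transform k a n"
proof -
  let ?b = "\<lambda>i. a (Suc i)"
  let ?A = "rising_k_binomial_transform k a"
  let ?B = "rising_k_binomial_transform k ?b"
  have A: "?A (Suc m) = ?A m + k * ?B m" for m
    by (rule rising_k_binomial_transform_Suc)
  have B: "?B (Suc n) = ?B n + k * (k * ?B n + ?A n)"
    using rising_k_binomial_transform_Suc[of k ?b n]
    by (simp add: assms rising_k_binomial_transform_linear)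
  show ?thesis
    unfolding A[of "Suc n"] B A[of n] by (simp add: algebra_simps power2_eq_square)
qed

text \<open>Both sides satisfy the same second-order recurrence and agree at \<open>0\<close> and \<open>1\<close>. The
  product of the roots being \<open>1\<close> makes the inverse powers at \<open>n = 0\<close> combine to
  \<open>(t1 powi (-1) - t2 powi (-1)) / (t1 - t2) = -1\<close>.\<close>

lemma binet_formula_unit_product:
  fixes s :: "nat \<Rightarrow> 'a::field"
  assumes "t1 \<noteq> t2" and prod: "t1 * t2 = 1"
    and rec: "\<And>n. s (Suc (Suc n)) = (t1 + t2) * s (Suc n) - s n"
  shows "s n = s 1 * ((t1 ^ n - t2 ^ n) / (t1 - t2))
      - s 0 * ((t1 powi (int n - 1) - t2 powi (int n - 1)) / (t1 - t2))"
proof -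
  have nz: "t1 \<noteq> 0" "t2 \<noteq> 0" "t1 - t2 \<noteq> 0"
    using assms by auto
  have inv: "inverse t1 = t2" "inverse t2 = t1"
    using prod by (auto intro: inverse_unique simp: mult.commute)
  have powi: "t1 powi (int m - 1) = t1 ^ m * t2" "t2 powi (int m - 1) = t2 ^ m * t1" for m
    using nz by (simp_all add: power_int_diff divide_inverse inv)
  \<comment> \<open>Clearing the denominator leaves a polynomial identity in \<open>t1\<close> and \<open>t2\<close>.\<close>
  have "(t1 - t2) * s n = s 1 * (t1 ^ n - t2 ^ n) - s 0 * (t1 ^ n * t2 - t2 ^ n * t1)"
  proof (induction n rule: induct_nat_012)
    case 0
    show ?case by (simp add: algebra_simps)
  next
    case 1
    show ?case by (simp add: algebra_simps)
  next
    case (ge2 n)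
    have root: "t1 ^ Suc (Suc n) = (t1 + t2) * t1 ^ Suc n - t1 ^ n"
        "t2 ^ Suc (Suc n) = (t1 + t2) * t2 ^ Suc n - t2 ^ n"
    proof -
      have "(t1 + t2) * t1 ^ Suc n - t1 ^ n = t1 ^ Suc (Suc n) + (t1 * t2 - 1) * t1 ^ n"
           "(t1 + t2) * t2 ^ Suc n - t2 ^ n = t2 ^ Suc (Suc n) + (t1 * t2 - 1) * t2 ^ n"
        by (simp_all add: algebra_simps)
      then show "t1 ^ Suc (Suc n) = (t1 + t2) * t1 ^ Suc n - t1 ^ n"
          "t2 ^ Suc (Suc n) = (t1 + t2) * t2 ^ Suc n - t2 ^ n"
        by (simp_all add: prod)
    qed
    have "(t1 - t2) * s (Suc (Suc n)) =
        (t1 + t2) * ((t1 - t2) * s (Suc n)) - (t1 - t2) * s n"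
      unfolding rec by (simp add: algebra_simps)
    also have "\<dots> = s 1 * (t1 ^ Suc (Suc n) - t2 ^ Suc (Suc n))
        - s 0 * (t1 ^ Suc (Suc n) * t2 - t2 ^ Suc (Suc n) * t1)"
      unfolding ge2 root by (simp only: algebra_simps)
    finally show ?case .
  qed
  then have "s n = (s 1 * (t1 ^ n - t2 ^ n) - s 0 * (t1 ^ n * t2 - t2 ^ n * t1)) / (t1 - t2)"
    using nz(3) by (metis nonzero_mult_div_cancel_left)
  then show ?thesis
    unfolding powi by (simp add: diff_divide_distrib right_diff_distrib)
qed

theorem theorem10:
  fixes k t1 t2 :: real and n :: nat
  assumes "k > 0"
    and "t1 > t2"
    and "t1\<^sup>2 - (k\<^sup>2 + 2) * t1 + 1 = 0"
    and "t2\<^sup>2 - (k\<^sup>2 + 2) * t2 + 1 = 0"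
  shows "rising_k_binomial_transform k (mod_k_fib k) n =
      (2 * k + 2) * ((t1 ^ n - t2 ^ n) / (t1 - t2))
      - 2 * ((t1 powi (int n - 1) - t2 powi (int n - 1)) / (t1 - t2))"
proof -
  let ?r = "rising_k_binomial_transform k (mod_k_fib k)"
  \<comment> \<open>Vieta: subtracting the two equations and cancelling \<open>t1 - t2\<close> gives the sum.\<close>
  have "(t1 - t2) * (t1 + t2 - (k\<^sup>2 + 2)) = 0"
    using assms(3,4) by (simp add: algebra_simps power2_eq_square)
  then have sum: "t1 + t2 = k\<^sup>2 + 2"
    using assms(2) by simp
  then have prod: "t1 * t2 = 1"
    using assms(3) unfolding sum[symmetric] by (simp add: algebra_simps power2_eq_square)
  have rec: "?r (Suc (Suc m)) = (t1 + t2) * ?r (Suc m) - ?r m" for m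
    unfolding sum by (rule rising_k_binomial_transform_recurrence) simp
  have init: "?r 0 = 2" "?r 1 = 2 * k + 2"
    by (simp_all add: rising_k_binomial_transform_def)
  show ?thesis
    using binet_formula_unit_product[of t1 t2 ?r n] assms(2) prod rec unfolding init by simp
qed

end
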